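(* Let $N\ge 1$, $\mathbf h=[h_1,\dots,h_N]^T\in\mathbb C^N$ with all $h_i\ne0$, and let $\sigma_\theta^2,\sigma_w^2,\sigma_{v,1}^2,\dots,\sigma_{v,N}^2,P>0$. Let $\mathbf H=\mathrm{diag}\{h_1,\dots,h_N\}$, $\mathbf V=\mathrm{diag}\{\sigma_{v,1}^2,\dots,\sigma_{v,N}^2\}$, $\mathbf D=\mathrm{diag}\{\sigma_\theta^2+\sigma_{v,1}^2,\dots,\sigma_\theta^2+\sigma_{v,N}^2\}$, and let $$\frac{P}{1+\left(\sum_{i=1}^N\frac1{\sigma_{v,i}^2}\right)P}<\epsilon\le P .$$ Put $\mathbf E=P\,\mathbf h\mathbf h^H-\left(\frac{P}{\epsilon}-1\right)\mathbf H\mathbf V\mathbf H^H$. Consider the problem of minimizing $\mathbf a^H\mathbf D\mathbf a$ over $\mathbf a\in\mathbb C^N$ subject to $\mathrm{MSE}(\mathbf a)\le\epsilon$, where $$\mathrm{MSE}(\mathbf a)=\left(1-\frac{P\,\mathbf a^H\mathbf h\mathbf h^H\mathbf a}{\mathbf a^H\mathbf H\mathbf V\mathbf H^H\mathbf a+P\,\mathbf a^H\mathbf h\mathbf h^H\mathbf a+\sigma_w^2}\right)P .$$ Let $\mathbf v_1$ be a unit-norm eigenvector of $\mathbf D^{-1/2}\mathbf E\mathbf D^{-1/2}$ for its largest eigenvalue. Then an optimal solution is $$\mathbf a^*=\sqrt{\frac{\left(\frac{P}{\epsilon}-1\right)\sigma_w^2}{\mathbf v_1^H\mathbf D^{-1/2}\mathbf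 E\mathbf D^{-1/2}\mathbf v_1}}\;\mathbf D^{-1/2}\mathbf v_1 ,$$ and the minimum value is $$P_T^*=\frac{(P-\epsilon)\sigma_w^2}{\epsilon\,\lambda_{\max}\{\mathbf D^{-1/2}\mathbf E\mathbf D^{-1/2}\}},$$ where $\lambda_{\max}$ denotes the largest eigenvalue.
   Context: $(\cdot)^H$ is the conjugate transpose. Setting: $\mathrm{MSE}(\mathbf a)$ is the filtered Kalman MSE $P_{n|n}$ at a fusion center (prediction MSE $P=P_{n|n-1}$, noise variance $\sigma_w^2$) receiving coherently summed amplified observations of a parameter of variance $\sigma_\theta^2$ from $N$ sensors with channels $h_i$, measurement noise variances $\sigma_{v,i}^2$ and (conjugated) gains $\mathbf a$; $\mathbf a^H\mathbf D\mathbf a$ is the total transmit power. *)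

theory Defs
  imports "Jordan_Normal_Form.Schur_Decomposition" "Jordan_Normal_Form.Spectral_Radius"
begin

definition outer_prod :: "complex vec \<Rightarrow> complex mat" where
  \<comment> \<open>the rank-one matrix $x x^H$\<close>
  "outer_prod x = mat (dim_vec x) (dim_vec x) (\<lambda>(i, j). x $ i * cnj (x $ j))"

definition hermitian_form :: "complex mat \<Rightarrow> complex vec \<Rightarrow> real" where
  \<comment> \<open>$x^H A x$; it is only used for Hermitian $A$, where the imaginary part vanishes
      (see \<open>hermitian_form_real\<close>)\<close>
  "hermitian_form A x = Re ((A *\<^sub>v x) \<bullet>c x)"

definition l2_norm :: "complex vec \<Rightarrow> real" where
  "l2_norm x = sqrt (\<Sum>i<dim_vec x. (cmod (x $ i))\<^sup>2)"

definition lambda_max :: "complex mat \<Rightarrow> real" where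
  \<comment> \<open>only used for Hermitian matrices, all of whose eigenvalues are real
      (see \<open>lambda_max_hermitian\<close>)\<close>
  "lambda_max A = Max {x :: real. eigenvalue A (complex_of_real x)}"

definition mat_D :: "nat \<Rightarrow> real \<Rightarrow> (nat \<Rightarrow> real) \<Rightarrow> complex mat" where
  "mat_D N sth2 sv2 = mat_diag N (\<lambda>i. complex_of_real (sth2 + sv2 i))"

definition mat_D_inv_sqrt :: "nat \<Rightarrow> real \<Rightarrow> (nat \<Rightarrow> real) \<Rightarrow> complex mat" where
  "mat_D_inv_sqrt N sth2 sv2 = mat_diag N (\<lambda>i. complex_of_real (1 / sqrt (sth2 + sv2 i)))"

definition mat_HVH :: "nat \<Rightarrow> complex vec \<Rightarrow> (nat \<Rightarrow> real) \<Rightarrow> complex mat" where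
  "mat_HVH N h sv2 =
     mat_diag N (\<lambda>i. h $ i) * mat_diag N (\<lambda>i. complex_of_real (sv2 i))
       * mat_adjoint (mat_diag N (\<lambda>i. h $ i))"

definition mat_E :: "nat \<Rightarrow> complex vec \<Rightarrow> (nat \<Rightarrow> real) \<Rightarrow> real \<Rightarrow> real \<Rightarrow> complex mat" where
  "mat_E N h sv2 P eps =
     complex_of_real P \<cdot>\<^sub>m outer_prod h - complex_of_real (P / eps - 1) \<cdot>\<^sub>m mat_HVH N h sv2"

definition MSE ::
  "nat \<Rightarrow> complex vec \<Rightarrow> (nat \<Rightarrow> real) \<Rightarrow> real \<Rightarrow> real \<Rightarrow> complex vec \<Rightarrow> real" where
  "MSE N h sv2 sw2 P a =
     (1 - P * hermitian_form (outer_prod h) a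
          / (hermitian_form (mat_HVH N h sv2) a + P * hermitian_form (outer_prod h) a + sw2)) * P"


lemma index_mat_adjoint:
  assumes "A \<in> carrier_mat n n" "i < n" "j < n"
  shows "mat_adjoint A $$ (i, j) = conjugate (A $$ (j, i))"
  using assms unfolding mat_adjoint_def by (auto simp: mat_of_rows_index)

lemma hermitian_form_real:
  assumes A: "A \<in> carrier_mat n n" and herm: "mat_adjoint A = A" and x: "x \<in> carrier_vec n"
  shows "(A *\<^sub>v x) \<bullet>c x = complex_of_real (hermitian_form A x)"
proof -
  have entry: "cnj (A $$ (i, j)) = A $$ (j, i)" if "i < n" "j < n" for i j
    using index_mat_adjoint[OF A that(2,1)] herm by simp
  have exp: "(A *\<^sub>v x) \<bullet>c x = (\<Sum>i<n. \<Sum>j<n. A $$ (i, j) * x $ j * cnj (x $ i))"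
    using A x by (auto simp: scalar_prod_def sum_distrib_right lessThan_atLeast0 intro!: sum.cong)
  have "cnj ((A *\<^sub>v x) \<bullet>c x) = (\<Sum>i<n. \<Sum>j<n. A $$ (j, i) * x $ i * cnj (x $ j))"
    unfolding exp by (auto simp: entry intro!: sum.cong)
  also have "\<dots> = (A *\<^sub>v x) \<bullet>c x"
    unfolding exp by (rule sum.swap)
  finally show ?thesis
    unfolding hermitian_form_def using Reals_cnj_iff by (metis of_real_Re)
qed

lemma hermitian_eigenvalue_real:
  assumes A: "A \<in> carrier_mat n n" and herm: "mat_adjoint A = A" and ev: "eigenvalue A k"
  shows "k = complex_of_real (Re k)"
proof -
  obtain x where x: "x \<in> carrier_vec n" "x \<noteq> 0\<^sub>v n" and Ax: "A *\<^sub>v x = k \<cdot>\<^sub>v x"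
    using ev A unfolding eigenvalue_def eigenvector_def by auto
  have sq: "x \<bullet>c x = complex_of_real (\<Sum>i<n. (cmod (x $ i))\<^sup>2)"
    using x(1) by (auto simp: scalar_prod_def lessThan_atLeast0 complex_norm_square
        simp del: of_real_power intro!: sum.cong)
  have ne: "x \<bullet>c x \<noteq> 0"
    using x conjugate_square_eq_0_vec by blast
  have "(A *\<^sub>v x) \<bullet>c x = k * (x \<bullet>c x)"
    unfolding Ax using x by simp
  then have "k = complex_of_real (hermitian_form A x) / (x \<bullet>c x)"
    using hermitian_form_real[OF A herm x(1)] ne by simp
  also have "\<dots> = complex_of_real (hermitian_form A x / (\<Sum>i<n. (cmod (x $ i))\<^sup>2))"
    unfolding sq by simp
  finally show ?thesis by simp
qed

lemma lambda_max_hermitian: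
  assumes A: "A \<in> carrier_mat n n" and herm: "mat_adjoint A = A" and n: "n \<ge> 1"
  shows "eigenvalue A (complex_of_real (lambda_max A))"
    and "eigenvalue A k \<Longrightarrow> k \<in> \<real> \<and> Re k \<le> lambda_max A"
proof -
  let ?S = "{x :: real. eigenvalue A (complex_of_real x)}"
  have S: "?S = Re ` spectrum A"
    using hermitian_eigenvalue_real[OF A herm] unfolding spectrum_def
    by (auto simp: image_iff) force+
  have fin: "finite ?S" and ne: "?S \<noteq> {}"
    unfolding S using card_finite_spectrum(1)[OF A] spectrum_non_empty[OF A] n by auto
  show "eigenvalue A (complex_of_real (lambda_max A))"
    using Max_in[OF fin ne] unfolding lambda_max_def by auto
  show "k \<in> \<real> \<and> Re k \<le> lambda_max A" if "eigenvalue A k"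
    using hermitian_eigenvalue_real[OF A herm that] that Max_ge[OF fin, of "Re k"]
    unfolding lambda_max_def by (metis Reals_of_real mem_Collect_eq)
qed

lemma mat_D_inv_sqrt:
  assumes "sth2 > 0" "\<And>i. i < N \<Longrightarrow> sv2 i > 0"
  shows "mat_D_inv_sqrt N sth2 sv2 * mat_D_inv_sqrt N sth2 sv2 * mat_D N sth2 sv2 = 1\<^sub>m N"
proof -
  have "complex_of_real (1 / sqrt (sth2 + sv2 i)) * complex_of_real (1 / sqrt (sth2 + sv2 i))
      * complex_of_real (sth2 + sv2 i) = 1" if "i < N" for i
  proof -
    have "1 / sqrt (sth2 + sv2 i) * (1 / sqrt (sth2 + sv2 i)) * (sth2 + sv2 i) = 1"
      using assms(1) assms(2)[OF that] by simp
    then show ?thesis by (metis of_real_1 of_real_mult)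
  qed
  then show ?thesis
    unfolding mat_D_inv_sqrt_def mat_D_def mat_diag_diag
    by (intro eq_matI) (auto simp: mat_diag_def)
qed

end

theory Submission
  imports Defs "HOL-Analysis.L2_Norm"
begin

text \<open>
  Clearing the positive denominator turns $\mathrm{MSE}(a) \le \epsilon$ into
  $a^H E a \ge (P/\epsilon - 1) \sigma_w^2$, and $a = D^{-1/2} y$ turns $a^H D a$ into $|y|^2$ and
  $a^H E a$ into $y^H M y$, so that everything rests on the Rayleigh bound
  $y^H M y \le \lambda_{\max} |y|^2$ with $\lambda_{\max} > 0$.  No spectral theorem is needed:
  $M = u u^H - \mathrm{diag}(d)$ with $d \ge 0$, and the lower bound on $\epsilon$ says exactly that
  the secular equation $\sum_i |u_i|^2 / (\mu + d_i) = 1$ has a root $\mu > 0$.  Then $\mu$ is an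
  eigenvalue, with eigenvector $u_i / (\mu + d_i)$, and the Cauchy--Schwarz inequality with weights
  $\mu + d_i$ gives $y^H M y \le \mu |y|^2$.
\<close>

section \<open>Norms and Hermitian forms of rank-one and diagonal matrices\<close>

lemma l2_norm_power2: "(l2_norm x)\<^sup>2 = (\<Sum>i<dim_vec x. (cmod (x $ i))\<^sup>2)"
  unfolding l2_norm_def by (simp add: sum_nonneg)

lemma l2_norm_pos:
  assumes "x \<in> carrier_vec n" "x \<noteq> 0\<^sub>v n"
  shows "l2_norm x > 0"
proof -
  obtain i where i: "i < n" "x $ i \<noteq> 0"
    using assms by (metis eq_vecI carrier_vecD index_zero_vec)
  then have "(\<Sum>i<n. (cmod (x $ i))\<^sup>2) > 0"
    by (intro sum_pos2[of _ i]) auto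
  then show ?thesis
    using assms(1) unfolding l2_norm_def by simp
qed

lemma l2_norm_smult: "l2_norm (c \<cdot>\<^sub>v x) = cmod c * l2_norm x"
  unfolding l2_norm_def
  by (simp add: norm_mult power_mult_distrib real_sqrt_mult flip: sum_distrib_left)

lemma scalar_prod_conjugate_self:
  "x \<bullet>c x = complex_of_real ((l2_norm x)\<^sup>2)"
  unfolding l2_norm_power2
  by (auto simp: scalar_prod_def lessThan_atLeast0 complex_norm_square
      simp del: of_real_power intro!: sum.cong)

lemma hermitian_form_eigenvector:
  assumes "A \<in> carrier_mat n n" "eigenvector A v (complex_of_real k)"
  shows "hermitian_form A v = k * (l2_norm v)\<^sup>2"
proof -
  have v: "v \<in> carrier_vec n" and Av: "A *\<^sub>v v = complex_of_real k \<cdot>\<^sub>v v"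
    using assms unfolding eigenvector_def by auto
  show ?thesis
    unfolding hermitian_form_def Av using v
    by (simp add: scalar_prod_conjugate_self)
qed

lemma hermitian_form_smult_vec:
  assumes "A \<in> carrier_mat n n" "x \<in> carrier_vec n"
  shows "hermitian_form A (c \<cdot>\<^sub>v x) = (cmod c)\<^sup>2 * hermitian_form A x"
proof -
  have "(A *\<^sub>v (c \<cdot>\<^sub>v x)) \<bullet>c (c \<cdot>\<^sub>v x) = (c * cnj c) * ((A *\<^sub>v x) \<bullet>c x)"
    using assms by (simp add: mult_mat_vec conjugate_smult_vec)
  also have "c * cnj c = complex_of_real ((cmod c)\<^sup>2)"
    using complex_norm_square by metis
  finally show ?thesis
    unfolding hermitian_form_def by (simp del: of_real_power)
qed

lemma hermitian_form_minus:
  assumes "A \<in> carrier_mat n n" "B \<in> carrier_mat n n" "x \<in> carrier_vec n"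
  shows "hermitian_form (A - B) x = hermitian_form A x - hermitian_form B x"
proof -
  have "(A - B) *\<^sub>v x = A *\<^sub>v x - B *\<^sub>v x"
    using assms by (simp add: minus_mult_distrib_mat_vec)
  then show ?thesis
    using assms unfolding hermitian_form_def
    by (simp add: minus_scalar_prod_distrib[of _ n])
qed

lemma hermitian_form_smult_mat:
  assumes "A \<in> carrier_mat n n" "x \<in> carrier_vec n"
  shows "hermitian_form (complex_of_real c \<cdot>\<^sub>m A) x = c * hermitian_form A x"
proof -
  have "(complex_of_real c \<cdot>\<^sub>m A) *\<^sub>v x = complex_of_real c \<cdot>\<^sub>v (A *\<^sub>v x)"
    using assms by (intro eq_vecI) auto
  then show ?thesis
    using assms unfolding hermitian_form_def by simp
qed

lemma outer_prod_carrier [simp]: "u \<in> carrier_vec n \<Longrightarrow> outer_prod u \<in> carrier_mat n n"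
  unfolding outer_prod_def by auto

lemma outer_prod_mult_vec:
  assumes "u \<in> carrier_vec n" "x \<in> carrier_vec n"
  shows "outer_prod u *\<^sub>v x = (x \<bullet>c u) \<cdot>\<^sub>v u"
  using assms unfolding outer_prod_def
  by (intro eq_vecI) (auto simp: scalar_prod_def sum_distrib_right intro!: sum.cong)

lemma hermitian_form_outer_prod:
  assumes "u \<in> carrier_vec n" "x \<in> carrier_vec n"
  shows "hermitian_form (outer_prod u) x = (cmod (x \<bullet>c u))\<^sup>2"
proof -
  have "u \<bullet>c x = cnj (x \<bullet>c u)"
    using assms by (auto simp: scalar_prod_def mult.commute intro!: sum.cong)
  then have "(outer_prod u *\<^sub>v x) \<bullet>c x = (x \<bullet>c u) * cnj (x \<bullet>c u)"
    unfolding outer_prod_mult_vec[OF assms] using assms by simp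
  also have "\<dots> = complex_of_real ((cmod (x \<bullet>c u))\<^sup>2)"
    using complex_norm_square by metis
  finally show ?thesis
    unfolding hermitian_form_def by simp
qed

lemma mat_diag_mult_vec:
  assumes "x \<in> carrier_vec n"
  shows "mat_diag n f *\<^sub>v x = vec n (\<lambda>i. f i * x $ i)"
proof (intro eq_vecI)
  fix i assume "i < dim_vec (vec n (\<lambda>i. f i * x $ i))"
  then have i: "i < n" by simp
  have "(mat_diag n f *\<^sub>v x) $ i = (\<Sum>j=0..<n. (if i = j then f j else 0) * x $ j)"
    using i assms by (simp add: mat_diag_def scalar_prod_def)
  also have "\<dots> = (\<Sum>j=0..<n. if i = j then f i * x $ i else 0)"
    by (intro sum.cong) auto
  finally have "(mat_diag n f *\<^sub>v x) $ i = (\<Sum>j=0..<n. if i = j then f i * x $ i else 0)" .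
  then show "(mat_diag n f *\<^sub>v x) $ i = vec n (\<lambda>i. f i * x $ i) $ i"
    using i by simp
qed (simp add: mat_diag_def)

lemma hermitian_form_mat_diag:
  assumes "x \<in> carrier_vec n"
  shows "hermitian_form (mat_diag n (\<lambda>i. complex_of_real (d i))) x
    = (\<Sum>i<n. d i * (cmod (x $ i))\<^sup>2)"
proof -
  have "(mat_diag n (\<lambda>i. complex_of_real (d i)) *\<^sub>v x) \<bullet>c x
      = (\<Sum>i<n. complex_of_real (d i) * (x $ i * cnj (x $ i)))"
    unfolding mat_diag_mult_vec[OF assms] using assms
    by (auto simp: scalar_prod_def lessThan_atLeast0 mult.assoc intro!: sum.cong)
  also have "\<dots> = complex_of_real (\<Sum>i<n. d i * (cmod (x $ i))\<^sup>2)"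
    by (simp add: complex_norm_square del: of_real_power)
  finally show ?thesis
    unfolding hermitian_form_def by simp
qed

text \<open>A real diagonal \<open>S\<close> is self-adjoint, so the outer factor moves across the
  inner product. With \<open>S\<close> equal to D^{-1/2} this is the change of variables a =
  D^{-1/2} x.\<close>

lemma hermitian_form_diag_congruence:
  assumes A: "A \<in> carrier_mat n n" and x: "x \<in> carrier_vec n"
    and S: "S = mat_diag n (\<lambda>i. complex_of_real (s i))"
  shows "hermitian_form (S * A * S) x = hermitian_form A (S *\<^sub>v x)"
proof -
  have Sc: "S \<in> carrier_mat n n" unfolding S by simp
  define y where "y = A *\<^sub>v (S *\<^sub>v x)"
  have y: "y \<in> carrier_vec n" unfolding y_def using A Sc x by auto
  have "(S * A * S) *\<^sub>v x = S *\<^sub>v y"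
    unfolding y_def using A Sc x
    by (simp add: assoc_mult_mat_vec[of _ n n _ n])
  moreover have "(S *\<^sub>v y) \<bullet>c x = y \<bullet>c (S *\<^sub>v x)"
    unfolding S mat_diag_mult_vec[OF x] mat_diag_mult_vec[OF y] using x y
    by (auto simp: scalar_prod_def intro!: sum.cong)
  ultimately show ?thesis
    unfolding hermitian_form_def y_def by simp
qed

section \<open>The secular equation and its positive root\<close>

text \<open>For t > 0 the sum is continuous in \<mu> on [0, \<infinity>). At \<mu> = 0 it is (\<Sum>
  c_i / k_i) / t, which the strict bound on \<open>t\<close> puts above 1, and for large \<mu> it
  drops to 1 or below; the intermediate value theorem gives the root.\<close>

lemma ex_secular_root:
  fixes c k :: "nat \<Rightarrow> real"
  assumes n: "n \<ge> 1" and c: "\<And>i. i < n \<Longrightarrow> c i > 0" and k: "\<And>i. i < n \<Longrightarrow> k i > 0"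
    and t: "0 \<le> t" "t < (\<Sum>i<n. c i / k i)"
  shows "\<exists>\<mu>>0. (\<Sum>i<n. c i / (\<mu> + t * k i)) = 1"
proof -
  \<comment> \<open>\<open>C\<close> is the root itself when t = 0. When t > 0 it is the right end
    of the bracketing interval: there each denominator is at least \<open>C\<close>, so the sum is
    at most C / C.\<close>
  define C where "C = (\<Sum>i<n. c i)"
  have C: "C > 0"
    unfolding C_def using n c by (intro sum_pos) (auto simp: lessThan_empty_iff)
  show ?thesis
  proof (cases "t = 0")
    \<comment> \<open>here the sum has its pole at $\mu = 0$, where Isabelle's division gives 0, so the
        intermediate value theorem cannot start there\<close>
    case True
    then have "(\<Sum>i<n. c i / (C + t * k i)) = 1"
      using C by (simp add: C_def flip: sum_divide_distrib)
    then show ?thesis using C by blast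
  next
    case False
    with t have t0: "t > 0" by simp
    define f where "f \<mu> = (\<Sum>i<n. c i / (\<mu> + t * k i))" for \<mu>
    have pos: "\<mu> + t * k i > 0" if "\<mu> \<ge> 0" "i < n" for \<mu> i
      using that k[of i] t0 by (simp add: add_nonneg_pos)
    have "f 0 = (\<Sum>i<n. c i / k i) / t"
      unfolding f_def by (simp add: sum_divide_distrib mult.commute)
    then have f0: "f 0 > 1" using t0 t by simp
    have "f C \<le> (\<Sum>i<n. c i / C)"
      unfolding f_def
      using C c k t0 by (intro sum_mono divide_left_mono) (auto simp: less_imp_le pos)
    also have "\<dots> = 1" using C by (simp add: C_def flip: sum_divide_distrib)
    finally have fC: "f C \<le> 1" .
    have "continuous_on {0..C} f"
      unfolding f_def using pos
      by (intro continuous_intros) (metis atLeastAtMost_iff lessThan_iff less_irrefl)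
    then obtain \<mu> where \<mu>: "0 \<le> \<mu>" "f \<mu> = 1"
      using IVT2'[of f C 1 0] f0 fC C by auto
    then have "\<mu> \<noteq> 0" using f0 by auto
    with \<mu> show ?thesis unfolding f_def by (intro exI[of _ \<mu>]) auto
  qed
qed

text \<open>Cauchy-Schwarz is applied to the factors |u_i| / sqrt (\<mu> + d_i) and sqrt (\<mu> +
  d_i) |x_i|. The secular equation makes the first of norm 1. The second has squared norm \<mu>
  |x|^2 plus the form of diag(d) at x, and this last term is exactly what the matrix
  subtracts.\<close>

lemma secular_root_form_le:
  assumes u: "u \<in> carrier_vec n" and x: "x \<in> carrier_vec n"
    and pos: "\<And>i. i < n \<Longrightarrow> \<mu> + d i > 0"
    and root: "(\<Sum>i<n. (cmod (u $ i))\<^sup>2 / (\<mu> + d i)) = 1"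
  shows "hermitian_form (outer_prod u - mat_diag n (\<lambda>i. complex_of_real (d i))) x
    \<le> \<mu> * (l2_norm x)\<^sup>2"
proof -
  have "x \<bullet>c u = (\<Sum>i<n. x $ i * cnj (u $ i))"
    using x u by (auto simp: scalar_prod_def lessThan_atLeast0 intro!: sum.cong)
  then have "cmod (x \<bullet>c u) \<le> (\<Sum>i<n. cmod (x $ i * cnj (u $ i)))"
    using norm_sum by metis
  \<comment> \<open>The square roots cancel because \<mu> + d_i > 0; the absolute values only match
    the shape of \<open>L2_set_mult_ineq\<close>.\<close>
  also have "\<dots> = (\<Sum>i<n. \<bar>cmod (u $ i) / sqrt (\<mu> + d i)\<bar> * \<bar>sqrt (\<mu> + d i) * cmod (x $ i)\<bar>)"
    using pos by (intro sum.cong) (auto simp: norm_mult abs_mult less_imp_neq[symmetric])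
  also have "\<dots> \<le> L2_set (\<lambda>i. cmod (u $ i) / sqrt (\<mu> + d i)) {..<n}
      * L2_set (\<lambda>i. sqrt (\<mu> + d i) * cmod (x $ i)) {..<n}"
    by (rule L2_set_mult_ineq)
  finally have "(cmod (x \<bullet>c u))\<^sup>2 \<le> (L2_set (\<lambda>i. cmod (u $ i) / sqrt (\<mu> + d i)) {..<n}
      * L2_set (\<lambda>i. sqrt (\<mu> + d i) * cmod (x $ i)) {..<n})\<^sup>2"
    by (intro power_mono) auto
  also have "\<dots> = (\<Sum>i<n. (cmod (u $ i) / sqrt (\<mu> + d i))\<^sup>2)
      * (\<Sum>i<n. (sqrt (\<mu> + d i) * cmod (x $ i))\<^sup>2)"
    unfolding power_mult_distrib[of "L2_set _ _"] by (simp add: L2_set_def sum_nonneg)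
  also have "(\<Sum>i<n. (cmod (u $ i) / sqrt (\<mu> + d i))\<^sup>2) = 1"
    unfolding root[symmetric] using pos
    by (intro sum.cong) (auto simp: power_divide less_imp_le)
  also have "(\<Sum>i<n. (sqrt (\<mu> + d i) * cmod (x $ i))\<^sup>2) = (\<Sum>i<n. (\<mu> + d i) * (cmod (x $ i))\<^sup>2)"
    using pos by (intro sum.cong) (auto simp: power_mult_distrib less_imp_le)
  also have "\<dots> = \<mu> * (l2_norm x)\<^sup>2 + (\<Sum>i<n. d i * (cmod (x $ i))\<^sup>2)"
    using x by (simp add: l2_norm_power2 algebra_simps sum.distrib sum_distrib_left)
  finally show ?thesis
    using u x by (simp add: hermitian_form_minus[of _ n] hermitian_form_outer_prod
        hermitian_form_mat_diag)
qed

text \<open>Coordinatewise the eigenvector equation reads (\<mu> + d_i) y_i = (y \<bullet>c u) u_i.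
  Scaling y so that the inner product is 1 determines y, and the secular equation is precisely the
  consistency condition y \<bullet>c u = 1.\<close>

lemma secular_root_eigenvalue:
  assumes u: "u \<in> carrier_vec n"
    and pos: "\<And>i. i < n \<Longrightarrow> \<mu> + d i > 0"
    and root: "(\<Sum>i<n. (cmod (u $ i))\<^sup>2 / (\<mu> + d i)) = 1"
  shows "eigenvalue (outer_prod u - mat_diag n (\<lambda>i. complex_of_real (d i))) (complex_of_real \<mu>)"
proof -
  let ?A = "outer_prod u - mat_diag n (\<lambda>i. complex_of_real (d i))"
  define y where "y = vec n (\<lambda>i. u $ i / complex_of_real (\<mu> + d i))"
  have y: "y \<in> carrier_vec n" unfolding y_def by simp
  have "y \<bullet>c u = (\<Sum>i<n. (u $ i * cnj (u $ i)) / complex_of_real (\<mu> + d i))"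
    using u unfolding y_def by (auto simp: scalar_prod_def lessThan_atLeast0 intro!: sum.cong)
  also have "\<dots> = complex_of_real (\<Sum>i<n. (cmod (u $ i))\<^sup>2 / (\<mu> + d i))"
    by (simp add: complex_norm_square del: of_real_power of_real_add)
  finally have yu: "y \<bullet>c u = 1" unfolding root by simp
  have "?A *\<^sub>v y = outer_prod u *\<^sub>v y - mat_diag n (\<lambda>i. complex_of_real (d i)) *\<^sub>v y"
    using u y by (intro minus_mult_distrib_mat_vec[of _ n n]) auto
  also have "\<dots> = complex_of_real \<mu> \<cdot>\<^sub>v y"
  proof (intro eq_vecI)
    fix i assume "i < dim_vec (complex_of_real \<mu> \<cdot>\<^sub>v y)"
    then have i: "i < n" using y by simp
    have "complex_of_real (\<mu> + d i) \<noteq> 0" using pos[OF i] by (metis of_real_eq_0_iff less_irrefl)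
    then have "u $ i = complex_of_real (\<mu> + d i) * y $ i"
      unfolding y_def using i by simp
    then show "(outer_prod u *\<^sub>v y - mat_diag n (\<lambda>i. complex_of_real (d i)) *\<^sub>v y) $ i
        = (complex_of_real \<mu> \<cdot>\<^sub>v y) $ i"
      using i u y by (simp add: outer_prod_mult_vec yu mat_diag_mult_vec algebra_simps)
  qed (use u y in \<open>simp add: outer_prod_mult_vec mat_diag_mult_vec\<close>)
  finally have "?A *\<^sub>v y = complex_of_real \<mu> \<cdot>\<^sub>v y" .
  \<comment> \<open>The zero vector would have inner product 0 with u, not 1.\<close>
  moreover have "y \<noteq> 0\<^sub>v n" using yu u by auto
  moreover have "?A \<in> carrier_mat n n" by (simp add: minus_carrier_mat)
  ultimately show ?thesis
    using y unfolding eigenvalue_def eigenvector_def by (metis carrier_matD(1))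
qed

section \<open>The MSE constraint as a quadratic inequality, and the structure of the scaled
  matrix\<close>

lemma mat_HVH_eq_diag:
  "mat_HVH N h sv2 = mat_diag N (\<lambda>i. complex_of_real ((cmod (h $ i))\<^sup>2 * sv2 i))"
proof -
  have "mat_adjoint (mat_diag N (\<lambda>i. h $ i)) = mat_diag N (\<lambda>i. cnj (h $ i))"
    by (intro eq_matI) (auto simp: mat_adjoint_def mat_of_rows_index mat_diag_def)
  then show ?thesis
    unfolding mat_HVH_def
    by (simp add: mat_diag_diag complex_norm_square ac_simps del: of_real_power)
qed

lemma hermitian_form_mat_E:
  assumes "h \<in> carrier_vec N" "a \<in> carrier_vec N"
  shows "hermitian_form (mat_E N h sv2 P eps) a
    = P * hermitian_form (outer_prod h) a - (P / eps - 1) * hermitian_form (mat_HVH N h sv2) a"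
proof -
  have "mat_HVH N h sv2 \<in> carrier_mat N N" unfolding mat_HVH_eq_diag by simp
  then show ?thesis
    using assms unfolding mat_E_def
    by (simp add: hermitian_form_minus[of _ N] hermitian_form_smult_mat[of _ N]
        del: of_real_diff of_real_divide)
qed

lemma MSE_le_iff:
  assumes h: "h \<in> carrier_vec N" and a: "a \<in> carrier_vec N"
    and "sw2 > 0" "P > 0" "eps > 0" and sv2: "\<And>i. i < N \<Longrightarrow> sv2 i > 0"
  shows "MSE N h sv2 sw2 P a \<le> eps
    \<longleftrightarrow> (P / eps - 1) * sw2 \<le> hermitian_form (mat_E N h sv2 P eps) a"
proof -
  define q where "q = hermitian_form (mat_HVH N h sv2) a"
  define r where "r = hermitian_form (outer_prod h) a"
  \<comment> \<open>Both forms are nonnegative at every \<open>a\<close>, so the noise variance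
    keeps the denominator of the MSE positive and it can be cleared.\<close>
  have "q \<ge> 0" unfolding q_def mat_HVH_eq_diag hermitian_form_mat_diag[OF a]
    using sv2 by (intro sum_nonneg) (auto simp: less_imp_le)
  moreover have "r \<ge> 0" unfolding r_def hermitian_form_outer_prod[OF h a] by simp
  ultimately have pos: "q + P * r + sw2 > 0" using assms by (simp add: add_nonneg_pos)
  have "MSE N h sv2 sw2 P a = (q + sw2) * P / (q + P * r + sw2)"
    unfolding MSE_def q_def[symmetric] r_def[symmetric] using pos by (simp add: field_simps)
  also have "\<dots> \<le> eps \<longleftrightarrow> (q + sw2) * P \<le> eps * (q + P * r + sw2)"
    using pos by (simp add: divide_le_eq)
  also have "\<dots> \<longleftrightarrow> (P / eps - 1) * sw2 \<le> P * r - (P / eps - 1) * q"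
  proof -
    \<comment> \<open>The gaps of the two inequalities differ by the factor \<open>eps\<close>, so
      they have the same sign.\<close>
    have "eps * (P * r - (P / eps - 1) * q - (P / eps - 1) * sw2)
        = eps * (q + P * r + sw2) - (q + sw2) * P"
      using \<open>eps > 0\<close> by (simp add: field_simps)
    then show ?thesis using \<open>eps > 0\<close>
      by (smt (verit) mult_nonneg_nonneg mult_pos_neg)
  qed
  finally show ?thesis
    unfolding hermitian_form_mat_E[OF h a] q_def r_def .
qed

text \<open>Multiplying by D^{-1/2} on both sides scales entry (i, j) by s_i s_j. This keeps the
  shape rank one minus diagonal: the rank-one vector becomes sqrt(P) D^{-1/2} h, and the diagonal
  entries are divided by those of D. The results on the secular equation then apply.\<close>

lemma scaled_mat_E_eq:
  assumes h: "h \<in> carrier_vec N" and "sth2 > 0" "P > 0" and sv2: "\<And>i. i < N \<Longrightarrow> sv2 i > 0"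
  shows "mat_D_inv_sqrt N sth2 sv2 * mat_E N h sv2 P eps * mat_D_inv_sqrt N sth2 sv2
    = outer_prod (vec N (\<lambda>i. complex_of_real (sqrt (P / (sth2 + sv2 i))) * h $ i))
      - mat_diag N (\<lambda>i. complex_of_real
          ((P / eps - 1) * ((cmod (h $ i))\<^sup>2 * sv2 i / (sth2 + sv2 i))))"
    (is "?L = ?R")
proof (intro eq_matI)
  define s where "s i = 1 / sqrt (sth2 + sv2 i)" for i
  define b where "b i = (P / eps - 1) * ((cmod (h $ i))\<^sup>2 * sv2 i)" for i
  have E: "mat_E N h sv2 P eps \<in> carrier_mat N N"
    unfolding mat_E_def mat_HVH_eq_diag by (auto intro!: minus_carrier_mat)
  have Eij: "mat_E N h sv2 P eps $$ (i, j) =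
      complex_of_real P * (h $ i * cnj (h $ j)) - (if i = j then complex_of_real (b i) else 0)"
    if "i < N" "j < N" for i j
    using that h unfolding mat_E_def mat_HVH_eq_diag b_def
    by (auto simp: outer_prod_def mat_diag_def)
  have L: "?L = mat N N (\<lambda>(i, j). complex_of_real (s i) * mat_E N h sv2 P eps $$ (i, j)
      * complex_of_real (s j))"
    using E unfolding mat_D_inv_sqrt_def s_def
    by (subst mat_diag_mult_left[of _ N N], assumption, subst mat_diag_mult_right[of _ N N])
       (auto intro!: eq_matI)
  fix i j assume "i < dim_row ?R" "j < dim_col ?R"
  then have ij: "i < N" "j < N" by (auto simp: mat_diag_def)
  have s2: "s i * s i = 1 / (sth2 + sv2 i)"
    unfolding s_def using assms(2) sv2[OF ij(1)] by simp
  have sP: "sqrt (P / (sth2 + sv2 l)) = sqrt P * s l" for l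
    unfolding s_def by (simp add: real_sqrt_divide)
  have PP: "complex_of_real (sqrt P) * complex_of_real (sqrt P) = complex_of_real P"
    using \<open>P > 0\<close> by (metis of_real_mult real_sqrt_mult_self abs_of_pos)
  have "?L $$ (i, j) = complex_of_real (s i * s j) * complex_of_real P * (h $ i * cnj (h $ j))
      - (if i = j then complex_of_real (b i * (s i * s i)) else 0)"
    unfolding L using ij by (simp add: Eij algebra_simps)
  also have "\<dots> = ?R $$ (i, j)"
    unfolding s2 PP[symmetric] using ij by (simp add: outer_prod_def mat_diag_def sP b_def)
  finally show "?L $$ (i, j) = ?R $$ (i, j)" .
qed (auto simp: mat_D_inv_sqrt_def mat_diag_def outer_prod_def)

section \<open>The Rayleigh bound for the scaled matrix\<close>

lemma scaled_mat_E_Rayleigh: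
  assumes N: "N \<ge> 1" and h: "h \<in> carrier_vec N" and h0: "\<And>i. i < N \<Longrightarrow> h $ i \<noteq> 0"
    and sth2: "sth2 > 0" and sv2: "\<And>i. i < N \<Longrightarrow> sv2 i > 0" and P: "P > 0"
    and eps: "P / (1 + (\<Sum>i<N. 1 / sv2 i) * P) < eps" "eps \<le> P"
    and M: "M = mat_D_inv_sqrt N sth2 sv2 * mat_E N h sv2 P eps * mat_D_inv_sqrt N sth2 sv2"
  shows "0 < lambda_max M" and "eigenvalue M (complex_of_real (lambda_max M))"
    and "x \<in> carrier_vec N \<Longrightarrow> hermitian_form M x \<le> lambda_max M * (l2_norm x)\<^sup>2"
proof -
  define S where "S = (\<Sum>i<N. 1 / sv2 i)"
  define t where "t = P / eps - 1"
  define k where "k i = (cmod (h $ i))\<^sup>2 * sv2 i / (sth2 + sv2 i)" for i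
  define u where "u = vec N (\<lambda>i. complex_of_real (sqrt (P / (sth2 + sv2 i))) * h $ i)"
  have u: "u \<in> carrier_vec N" unfolding u_def by simp
  have M_eq: "M = outer_prod u - mat_diag N (\<lambda>i. complex_of_real (t * k i))"
    unfolding M u_def t_def k_def by (rule scaled_mat_E_eq[OF h sth2 P sv2])
  have D: "sth2 + sv2 i > 0" if "i < N" for i using sth2 sv2[OF that] by simp
  have u2: "(cmod (u $ i))\<^sup>2 = P / (sth2 + sv2 i) * (cmod (h $ i))\<^sup>2" if "i < N" for i
    using that D[OF that] P unfolding u_def by (simp add: norm_mult power_mult_distrib)
  have k: "k i > 0" if "i < N" for i
    using that h0 sv2 D unfolding k_def by simp
  have c: "(cmod (u $ i))\<^sup>2 > 0" if "i < N" for i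
    unfolding u2[OF that] using that h0 P D by simp
  have "S \<ge> 0" unfolding S_def using sv2 by (intro sum_nonneg) (auto simp: less_imp_le)
  then have "1 + S * P > 0" using P by (simp add: add_pos_nonneg)
  moreover from this have "eps > 0" using eps(1) P unfolding S_def[symmetric]
    by (meson divide_pos_pos less_trans)
  \<comment> \<open>With t = P / eps - 1, the bound eps \<le> P becomes t \<ge> 0 and the strict
    lower bound on \<open>eps\<close> becomes t < S * P.\<close>
  ultimately have t: "0 \<le> t" "t < S * P"
    using eps unfolding t_def S_def[symmetric] by (auto simp: field_simps)
  \<comment> \<open>In each quotient |u_i|^2 / k_i the channel gain and the entry of D cancel,
    leaving P / sv2_i. Hence S * P is the threshold that \<open>ex_secular_root\<close>
    demands.\<close>
  have "S * P = (\<Sum>i<N. (cmod (u $ i))\<^sup>2 / k i)"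
    unfolding S_def sum_distrib_right
  proof (intro sum.cong refl)
    fix i assume "i \<in> {..<N}"
    then have "i < N" by simp
    then show "1 / sv2 i * P = (cmod (u $ i))\<^sup>2 / k i"
      using h0[of i] sv2[of i] D[of i] unfolding u2[OF \<open>i < N\<close>] k_def by simp
  qed
  then obtain \<mu> where \<mu>: "\<mu> > 0" "(\<Sum>i<N. (cmod (u $ i))\<^sup>2 / (\<mu> + t * k i)) = 1"
    using ex_secular_root[OF N _ _ t(1), of "\<lambda>i. (cmod (u $ i))\<^sup>2" k] c k t(2) by auto
  have pos: "\<mu> + t * k i > 0" if "i < N" for i
    using \<mu>(1) t(1) k[OF that] by (simp add: add_pos_nonneg)
  have Mc: "M \<in> carrier_mat N N" unfolding M_eq using u by (auto intro!: minus_carrier_mat)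
  \<comment> \<open>Hermitian symmetry makes all eigenvalues real, so that \<open>lambda_max\<close>
    is an eigenvalue and dominates every other one.\<close>
  have herm: "mat_adjoint M = M"
  proof (intro eq_matI)
    fix i j assume "i < dim_row M" "j < dim_col M"
    then have ij: "i < N" "j < N" using Mc by auto
    show "mat_adjoint M $$ (i, j) = M $$ (i, j)"
      unfolding index_mat_adjoint[OF Mc ij] using ij u
      by (auto simp: M_eq outer_prod_def mat_diag_def)
  qed (use Mc in \<open>auto simp: mat_adjoint_def\<close>)
  have "eigenvalue M (complex_of_real \<mu>)"
    unfolding M_eq by (rule secular_root_eigenvalue[OF u pos \<mu>(2)])
  \<comment> \<open>Since \<mu> is an eigenvalue, it lies below \<open>lambda_max M\<close>; the
    bound proved with \<mu> therefore carries over to \<open>lambda_max M\<close>, and so does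
    positivity.\<close>
  then have le: "\<mu> \<le> lambda_max M"
    using lambda_max_hermitian(2)[OF Mc herm N] by fastforce
  with \<mu>(1) show "0 < lambda_max M" by simp
  show "eigenvalue M (complex_of_real (lambda_max M))"
    by (rule lambda_max_hermitian(1)[OF Mc herm N])
  show "hermitian_form M x \<le> lambda_max M * (l2_norm x)\<^sup>2" if "x \<in> carrier_vec N"
  proof -
    have "hermitian_form M x \<le> \<mu> * (l2_norm x)\<^sup>2"
      unfolding M_eq by (rule secular_root_form_le[OF u that pos \<mu>(2)])
    also have "\<dots> \<le> lambda_max M * (l2_norm x)\<^sup>2"
      using le by (simp add: mult_right_mono)
    finally show ?thesis .
  qed
qed

section \<open>Optimal gains and minimum power\<close>

theorem mainTheorem4:
  fixes N :: nat and h :: "complex vec" and sv2 :: "nat \<Rightarrow> real"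
    and sth2 sw2 P eps :: real
    and M :: "complex mat"
  assumes "N \<ge> 1"
    and "h \<in> carrier_vec N" and "\<And>i. i < N \<Longrightarrow> h $ i \<noteq> 0"
    and "sth2 > 0" and "sw2 > 0" and "\<And>i. i < N \<Longrightarrow> sv2 i > 0" and "P > 0"
    and "P / (1 + (\<Sum>i<N. 1 / sv2 i) * P) < eps" and "eps \<le> P"
    and "M = mat_D_inv_sqrt N sth2 sv2 * mat_E N h sv2 P eps * mat_D_inv_sqrt N sth2 sv2"
  shows "(\<forall>v1. eigenvector M v1 (complex_of_real (lambda_max M)) \<and> l2_norm v1 = 1 \<longrightarrow>
            is_arg_min (hermitian_form (mat_D N sth2 sv2))
              (\<lambda>a. a \<in> carrier_vec N \<and> MSE N h sv2 sw2 P a \<le> eps)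
              (complex_of_real (sqrt ((P / eps - 1) * sw2 / hermitian_form M v1))
                \<cdot>\<^sub>v (mat_D_inv_sqrt N sth2 sv2 *\<^sub>v v1))) \<and>
         (\<exists>a. is_arg_min (hermitian_form (mat_D N sth2 sv2))
                (\<lambda>a. a \<in> carrier_vec N \<and> MSE N h sv2 sw2 P a \<le> eps) a \<and>
              hermitian_form (mat_D N sth2 sv2) a = (P - eps) * sw2 / (eps * lambda_max M))"
proof -
  let ?S = "mat_D_inv_sqrt N sth2 sv2" and ?E = "mat_E N h sv2 P eps"
  let ?power = "hermitian_form (mat_D N sth2 sv2)"
  let ?feasible = "\<lambda>a. a \<in> carrier_vec N \<and> MSE N h sv2 sw2 P a \<le> eps"
  define l where "l = lambda_max M"
  define m where "m = (P / eps - 1) * sw2"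
  define opt where "opt v = complex_of_real (sqrt (m / hermitian_form M v)) \<cdot>\<^sub>v (?S *\<^sub>v v)" for v
  note h = assms(2)
  note Rayleigh = scaled_mat_E_Rayleigh[OF assms(1,2) _ assms(4) _ assms(7-10), folded l_def]
  have Ray: "0 < l" "eigenvalue M (complex_of_real l)"
    "\<And>x. x \<in> carrier_vec N \<Longrightarrow> hermitian_form M x \<le> l * (l2_norm x)\<^sup>2"
    by (rule Rayleigh; use assms(3,6) in simp)+
  have D: "sth2 + sv2 i > 0" if "i < N" for i using assms(4) assms(6)[OF that] by simp
  \<comment> \<open>Positivity of \<open>eps\<close> comes from its strict lower bound, which is
    itself positive.\<close>
  have "(\<Sum>i<N. 1 / sv2 i) \<ge> 0"
    using assms(6) by (intro sum_nonneg) (auto simp: less_imp_le)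
  then have "P / (1 + (\<Sum>i<N. 1 / sv2 i) * P) > 0"
    using \<open>P > 0\<close> by (intro divide_pos_pos add_pos_nonneg) auto
  then have eps: "eps > 0" using assms(8) by simp
  \<comment> \<open>The value m = 0 occurs when eps = P; the optimal gain vector is then
    zero.\<close>
  then have m: "m \<ge> 0" unfolding m_def using assms(5,9) by simp
  have E: "?E \<in> carrier_mat N N"
    unfolding mat_E_def mat_HVH_eq_diag by (auto intro!: minus_carrier_mat)
  have S: "?S \<in> carrier_mat N N" unfolding mat_D_inv_sqrt_def by simp
  have Mc: "M \<in> carrier_mat N N" unfolding assms(10) using S by auto
  have form_M: "hermitian_form M x = hermitian_form ?E (?S *\<^sub>v x)" if "x \<in> carrier_vec N" for x
    unfolding assms(10)
    by (rule hermitian_form_diag_congruence[OF E that mat_D_inv_sqrt_def])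
  have power_S: "?power (?S *\<^sub>v x) = (l2_norm x)\<^sup>2" if "x \<in> carrier_vec N" for x
  proof -
    have "?S *\<^sub>v x \<in> carrier_vec N" using S that by simp
    then have "?power (?S *\<^sub>v x) = (\<Sum>i<N. (sth2 + sv2 i) * (cmod ((?S *\<^sub>v x) $ i))\<^sup>2)"
      unfolding mat_D_def by (rule hermitian_form_mat_diag)
    also have "\<dots> = (\<Sum>i<N. (cmod (x $ i))\<^sup>2)"
    proof (intro sum.cong refl)
      fix i assume "i \<in> {..<N}"
      then have i: "i < N" by simp
      show "(sth2 + sv2 i) * (cmod ((?S *\<^sub>v x) $ i))\<^sup>2 = (cmod (x $ i))\<^sup>2"
        using D[OF i] i unfolding mat_D_inv_sqrt_def mat_diag_mult_vec[OF that]
        by (simp add: norm_divide power_divide)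
    qed
    finally show ?thesis using that by (simp add: l2_norm_power2)
  qed
  have feasible: "?feasible a \<longleftrightarrow> a \<in> carrier_vec N \<and> m \<le> hermitian_form ?E a" for a
    using MSE_le_iff[OF h _ assms(5,7) eps, of a sv2] assms(6) unfolding m_def by blast
  have lower: "m / l \<le> ?power a" if "?feasible a" for a
  proof -
    \<comment> \<open>This is y = D^{1/2} a, the preimage of \<open>a\<close> under the change of
      variables; the Rayleigh bound at \<open>y\<close> gives m \<le> l |y|^2, and |y|^2 is the
      power of \<open>a\<close>.\<close>
    define y where "y = vec N (\<lambda>i. complex_of_real (sqrt (sth2 + sv2 i)) * a $ i)"
    have y: "y \<in> carrier_vec N" unfolding y_def by simp
    have Sy: "?S *\<^sub>v y = a"
    proof (intro eq_vecI)
      fix i assume "i < dim_vec a"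
      then have i: "i < N" using that by auto
      then show "(?S *\<^sub>v y) $ i = a $ i"
        using D[OF i] unfolding mat_D_inv_sqrt_def mat_diag_mult_vec[OF y]
        by (simp add: y_def)
    qed (use S that in auto)
    have "m \<le> hermitian_form M y"
      using that unfolding feasible form_M[OF y] Sy by simp
    also have "\<dots> \<le> l * (l2_norm y)\<^sup>2" by (rule Ray(3)[OF y])
    also have "\<dots> = l * ?power a" using power_S[OF y] unfolding Sy by simp
    finally show ?thesis using Ray(1) by (simp add: divide_le_eq mult.commute)
  qed
  \<comment> \<open>A unit eigenvector turns the Rayleigh bound into an equality. The factor sqrt (m
    / l) makes the constraint tight: the form of E takes the value m, while the power is m / l, the
    lower bound just found.\<close>
  have opt: "?feasible (opt v) \<and> ?power (opt v) = m / l"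
    if ev: "eigenvector M v (complex_of_real l)" and norm: "l2_norm v = 1" for v
  proof -
    have v: "v \<in> carrier_vec N" using ev Mc unfolding eigenvector_def by auto
    have Sv: "?S *\<^sub>v v \<in> carrier_vec N" using S v by simp
    have Mv: "hermitian_form M v = l" using hermitian_form_eigenvector[OF Mc ev] norm by simp
    have sq: "(cmod (complex_of_real (sqrt (m / l))))\<^sup>2 = m / l"
      using m Ray(1) by simp
    have "hermitian_form ?E (opt v) = m / l * l"
      unfolding opt_def Mv hermitian_form_smult_vec[OF E Sv] sq
      using form_M[OF v] Mv by simp
    moreover have "?power (opt v) = m / l * 1"
      unfolding opt_def Mv using hermitian_form_smult_vec[OF _ Sv, of "mat_D N sth2 sv2"]
        power_S[OF v] norm sq by (simp add: mat_D_def)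
    moreover have "opt v \<in> carrier_vec N" unfolding opt_def using Sv by simp
    ultimately show ?thesis unfolding feasible using Ray(1) by simp
  qed
  have arg_min: "is_arg_min ?power ?feasible (opt v)"
    if "eigenvector M v (complex_of_real l)" "l2_norm v = 1" for v
    using opt[OF that] lower unfolding is_arg_min_linorder by auto
  \<comment> \<open>The second conjunct asserts that a minimizer exists, so a unit eigenvector has
    to be produced, by normalizing an arbitrary one.\<close>
  obtain x where ev: "eigenvector M x (complex_of_real l)"
    using Ray(2) unfolding eigenvalue_def by blast
  then have x: "x \<in> carrier_vec N" "x \<noteq> 0\<^sub>v N" and Mx: "M *\<^sub>v x = complex_of_real l \<cdot>\<^sub>v x"
    using Mc unfolding eigenvector_def by auto
  define v where "v = complex_of_real (1 / l2_norm x) \<cdot>\<^sub>v x"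
  have norm: "l2_norm v = 1"
    unfolding v_def l2_norm_smult using l2_norm_pos[OF x] by (simp add: norm_divide)
  have "M *\<^sub>v v = complex_of_real l \<cdot>\<^sub>v v"
    unfolding v_def using x Mc Mx by (simp add: mult_mat_vec smult_smult_assoc mult.commute)
  moreover have "v \<noteq> 0\<^sub>v N"
    using norm unfolding l2_norm_def by auto
  ultimately have ev_v: "eigenvector M v (complex_of_real l)"
    using x Mc unfolding eigenvector_def v_def by auto
  have "m / l = (P - eps) * sw2 / (eps * lambda_max M)"
    unfolding m_def l_def using eps by (simp add: field_simps)
  with arg_min opt ev_v norm show ?thesis
    unfolding opt_def m_def l_def by (metis (lifting))
qed

end
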